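(* Let $f:\mathbb{R}^2\to\mathbb{R}^2$ be the diffeomorphism $$f(x,y)=\left(\frac{x}{2},\ y(1+x^2)\right),$$ and let $K_0=\{(x,y)\in\mathbb{R}^2:\ 0<|x|<1\}$. There exist a neighborhood $K$ of the origin in $\mathbb{R}^2$ and a number $c>0$ such that, for any $\varepsilon>0$ and any finite sequence of points $p_0,\dots,p_m\in K\cap K_0$ satisfying $$|f(p_k)-p_{k+1}|\leq d\,(p_k)_x^2,\qquad k=0,\dots,m-1,$$ with $d=c\varepsilon$, there exists a point $r\in\mathbb{R}^2$ such that $$|f^k(r)-p_k|\leq\varepsilon,\qquad 0\leq k\leq m.$$
   Context: For $p\in\mathbb{R}^2$, $p_x$ denotes its first coordinate, so $(p_k)_x$ is the first coordinate of $p_k$. $|\cdot|$ on $\mathbb{R}^2$ is the Euclidean norm. The number $c$ and the neighborhood $K$ do not depend on $\varepsilon$ or $m$. *)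

theory Defs
  imports "HOL-Analysis.Analysis"
begin

text \<open>The plane is modelled as the type \<open>real \<times> real\<close>, whose norm is the
  Euclidean one (\<open>norm_prod_def\<close>) and whose topology is the usual one.\<close>

definition f :: "real \<times> real \<Rightarrow> real \<times> real" where
  "f p = (case p of (x, y) \<Rightarrow> (x / 2, y * (1 + x\<^sup>2)))"

definition K0 :: "(real \<times> real) set" where
  "K0 = {(x, y). 0 < \<bar>x\<bar> \<and> \<bar>x\<bar> < 1}"

end

theory Submission
  imports Defs
begin

text \<open>The orbit of \<open>p 0\<close> itself is the shadowing orbit. The first coordinate is contracted, so
  along a pseudo-orbit it decays geometrically and the errors \<open>d x\<^sub>k\<^sup>2\<close> are summable; the second
  coordinate is stretched by the factors \<open>1 + x\<^sub>k\<^sup>2\<close>, whose product is bounded for the same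
  reason. For \<open>\<epsilon>\<close> at least the radius of \<open>K\<close> the fixed point \<open>0\<close> shadows trivially, so \<open>d\<close>
  may be taken small.\<close>

lemma funpow_f_Suc:
  "fst ((f ^^ Suc k) p) = fst ((f ^^ k) p) / 2"
  "snd ((f ^^ Suc k) p) = snd ((f ^^ k) p) * (1 + (fst ((f ^^ k) p))\<^sup>2)"
  by (simp_all add: f_def split: prod.split)

lemma funpow_f_zero: "(f ^^ k) 0 = 0"
  by (induction k) (simp_all add: f_def zero_prod_def)

text \<open>The noise is quadratic in \<open>u k\<close>, so for small \<open>d\<close> it only
  slightly weakens the contraction by 1/2, and the squares \<open>(u k)\<^sup>2\<close> decay at
  rate 9/16. Halving the old error and adding \<open>d * (9/16)^k / 4\<close> then preserves a bound
  \<open>C * d * (9/16)^k\<close> once 9/16 C = C/2 + 1/4, that is C = 4.\<close>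

lemma shadowing_first:
  fixes u X :: "nat \<Rightarrow> real"
  assumes d: "0 \<le> d" "d \<le> 1/32"
    and u0: "\<bar>u 0\<bar> \<le> 1/2"
    and X0: "X 0 = u 0" and X: "\<And>k. X (Suc k) = X k / 2"
    and u: "\<And>k. k < m \<Longrightarrow> \<bar>u k / 2 - u (Suc k)\<bar> \<le> d * (u k)\<^sup>2"
  shows "k \<le> m \<Longrightarrow> \<bar>u k\<bar> \<le> (3/4)^k / 2"
    and "\<bar>X k\<bar> \<le> (1/2)^k / 2"
    and "k \<le> m \<Longrightarrow> \<bar>u k - X k\<bar> \<le> 4 * d * (9/16)^k"
proof -
  show decay: "\<bar>u k\<bar> \<le> (3/4)^k / 2" if "k \<le> m" for k
    using that
  proof (induction k)
    case 0
    then show ?case using u0 by simp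
  next
    case (Suc k)
    have le: "\<bar>u k\<bar> \<le> (3/4)^k / 2" using Suc by simp
    moreover have "(3/4 :: real)^k \<le> 1" by (simp add: power_le_one)
    ultimately have "d * \<bar>u k\<bar> \<le> 1/32 * 1"
      using d by (intro mult_mono) auto
    then have "d * \<bar>u k\<bar> * \<bar>u k\<bar> \<le> 1/32 * \<bar>u k\<bar>"
      by (intro mult_right_mono) auto
    then have "d * (u k)\<^sup>2 \<le> \<bar>u k\<bar> / 32"
      by (simp add: power2_eq_square mult.assoc)
    \<comment> \<open>The actual factor is 1/2 + 1/32. The weaker 3/4 is convenient because its
      square 9/16 still exceeds 1/2, the rate at which earlier errors fade.\<close>
    then have "\<bar>u (Suc k)\<bar> \<le> 3/4 * \<bar>u k\<bar>"
      using u[of k] Suc.prems by linarith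
    also have "\<dots> \<le> 3/4 * ((3/4)^k / 2)" using le by (intro mult_left_mono) auto
    finally show ?case by simp
  qed
  show "\<bar>X k\<bar> \<le> (1/2)^k / 2" for k
  proof (induction k)
    case 0
    then show ?case using u0 X0 by simp
  next
    case (Suc k)
    then show ?case using X[of k] by simp
  qed
  show "\<bar>u k - X k\<bar> \<le> 4 * d * (9/16)^k" if "k \<le> m" for k
    using that
  proof (induction k)
    case 0
    then show ?case using X0 d by simp
  next
    case (Suc k)
    have "(u k)\<^sup>2 \<le> ((3/4)^k / 2)\<^sup>2"
      using power_mono[OF decay[of k], of 2] Suc.prems by simp
    also have "\<dots> = (9/16)^k / 4"
      by (simp add: power2_eq_square field_simps flip: power_mult_distrib)
    finally have "d * (u k)\<^sup>2 \<le> d * ((9/16)^k / 4)"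
      using d by (intro mult_left_mono)
    moreover have "\<bar>u k - X k\<bar> \<le> 4 * (d * (9/16)^k)"
      using Suc by (simp add: mult.assoc)
    ultimately have "\<bar>u (Suc k) - X (Suc k)\<bar> \<le> 2 * (d * (9/16)^k) + d * (9/16)^k / 4"
      using u[of k] X[of k] Suc.prems by linarith
    also have "\<dots> = 4 * d * (9/16)^Suc k" by simp
    finally show ?case .
  qed
qed

text \<open>With q = \<open>(9/16)^k\<close>, one step adds at most \<open>d * q\<close> times C/4 +
  2 + 1/4 to an error bounded by \<open>C * d\<close>. The bound \<open>C * d * (1 - q)\<close>
  leaves room for 7/16 C, and equality gives C = 12. The factor \<open>1 - q\<close> records how
  much of the summable total has been spent.\<close>

lemma shadowing_second:
  fixes u v X Y :: "nat \<Rightarrow> real"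
  assumes d: "0 \<le> d"
    and Y0: "Y 0 = v 0" and Y: "\<And>k. Y (Suc k) = Y k * (1 + (X k)\<^sup>2)"
    and v: "\<And>k. k < m \<Longrightarrow> \<bar>v k * (1 + (u k)\<^sup>2) - v (Suc k)\<bar> \<le> d * (u k)\<^sup>2"
    and u_le: "\<And>k. k < m \<Longrightarrow> \<bar>u k\<bar> \<le> (3/4)^k / 2"
    and v_le: "\<And>k. k < m \<Longrightarrow> \<bar>v k\<bar> \<le> 1/2"
    and X_le: "\<And>k. \<bar>X k\<bar> \<le> (1/2)^k / 2"
    and diff: "\<And>k. k < m \<Longrightarrow> \<bar>u k - X k\<bar> \<le> 4 * d * (9/16)^k"
    and "k \<le> m"
  shows "\<bar>v k - Y k\<bar> \<le> 12 * d * (1 - (9/16)^k)"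
  using \<open>k \<le> m\<close>
proof (induction k)
  case 0
  then show ?case using Y0 by simp
next
  case (Suc k)
  define q :: real where "q = (9/16)^k"
  have q: "0 < q" "q \<le> 1" by (simp_all add: q_def power_le_one)
  have k: "k < m" using Suc.prems by simp
  have "(u k)\<^sup>2 \<le> ((3/4)^k / 2)\<^sup>2" using power_mono[OF u_le[OF k], of 2] by simp
  also have "\<dots> = q / 4"
    by (simp add: q_def power2_eq_square field_simps flip: power_mult_distrib)
  finally have u2: "(u k)\<^sup>2 \<le> q / 4" .
  have "(X k)\<^sup>2 \<le> ((1/2)^k / 2)\<^sup>2" using power_mono[OF X_le[of k], of 2] by simp
  also have "\<dots> = (1/4)^k / 4"
    by (simp add: power2_eq_square field_simps flip: power_mult_distrib)
  \<comment> \<open>The true orbit decays faster; relaxing 1/4 to 9/16 gives all contributions the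
    common rate \<open>q\<close>.\<close>
  also have "\<dots> \<le> q / 4" by (simp add: q_def power_mono)
  finally have X2: "(X k)\<^sup>2 \<le> q / 4" .
  have "\<bar>u k\<bar> \<le> 1/2"
    using u_le[OF k] power_le_one[of "3/4::real" k] by simp
  moreover have "\<bar>X k\<bar> \<le> 1/2"
    using X_le[of k] power_le_one[of "1/2::real" k] by simp
  ultimately have "\<bar>u k - X k\<bar> * \<bar>u k + X k\<bar> \<le> 4 * d * q * 1"
    using diff[OF k] d q by (intro mult_mono) (auto simp: q_def)
  then have "\<bar>(u k)\<^sup>2 - (X k)\<^sup>2\<bar> \<le> 4 * d * q"
    by (simp add: power2_eq_square square_diff_square_factored abs_mult mult.commute)
  then have "\<bar>v k\<bar> * \<bar>(u k)\<^sup>2 - (X k)\<^sup>2\<bar> \<le> 1/2 * (4 * d * q)"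
    using v_le[OF k] by (intro mult_mono) auto
  then have drift: "\<bar>v k * ((u k)\<^sup>2 - (X k)\<^sup>2)\<bar> \<le> 2 * (d * q)"
    by (simp add: abs_mult)
  have noise: "d * (u k)\<^sup>2 \<le> d * q / 4"
    using mult_left_mono[OF u2 d] by simp
  have E: "\<bar>v k - Y k\<bar> \<le> 12 * d * (1 - q)" using Suc by (simp add: q_def)
  \<comment> \<open>For the growth term the uniform bound suffices, since
    \<open>(X k)\<^sup>2\<close> already supplies the factor \<open>q\<close>.\<close>
  also have "\<dots> \<le> 12 * d"
    using d q by (simp add: mult_left_le)
  finally have "\<bar>v k - Y k\<bar> * (X k)\<^sup>2 \<le> 12 * d * (q / 4)"
    using X2 d by (intro mult_mono) auto
  then have growth: "\<bar>(v k - Y k) * (X k)\<^sup>2\<bar> \<le> 3 * (d * q)"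
    by (simp add: abs_mult)
  \<comment> \<open>The new error splits into the old error, its stretching along the true orbit,
    the mismatch of the two stretching factors, and the pseudo-orbit noise.\<close>
  have "v (Suc k) - Y (Suc k) = (v k - Y k) + (v k - Y k) * (X k)\<^sup>2
      + v k * ((u k)\<^sup>2 - (X k)\<^sup>2) - (v k * (1 + (u k)\<^sup>2) - v (Suc k))"
    by (simp add: Y algebra_simps)
  then have "\<bar>v (Suc k) - Y (Suc k)\<bar>
      \<le> 12 * d * (1 - q) + 3 * (d * q) + 2 * (d * q) + d * q / 4"
    using E growth drift noise v[OF k] by linarith
  also have "\<dots> = 12 * d * (1 - 9/16 * q)" by (simp add: algebra_simps)
  finally show ?case by (simp add: q_def)
qed

theorem theorem5p1:
  shows "\<exists>(K :: (real \<times> real) set) (c :: real). 0 \<in> interior K \<and> c > 0 \<and>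
    (\<forall>(\<epsilon> :: real) (m :: nat) (p :: nat \<Rightarrow> real \<times> real).
      \<epsilon> > 0 \<longrightarrow>
      (\<forall>k\<le>m. p k \<in> K \<inter> K0) \<longrightarrow>
      (\<forall>k<m. norm (f (p k) - p (Suc k)) \<le> (c * \<epsilon>) * (fst (p k))\<^sup>2) \<longrightarrow>
      (\<exists>r :: real \<times> real. \<forall>k\<le>m. norm ((f ^^ k) r - p k) \<le> \<epsilon>))"
proof -
  \<comment> \<open>The radius 1/2 bounds both coordinates and is also the threshold for
    \<open>\<epsilon>\<close>: below it, d = \<open>\<epsilon> / 16\<close> is at most 1/32.\<close>
  let ?K = "ball (0 :: real \<times> real) (1/2)"
  have "\<exists>r. \<forall>k\<le>m. norm ((f ^^ k) r - p k) \<le> \<epsilon>"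
    if \<epsilon>: "\<epsilon> > 0" and pK: "\<forall>k\<le>m. p k \<in> ?K \<inter> K0"
      and ps: "\<forall>k<m. norm (f (p k) - p (Suc k)) \<le> (1/16 * \<epsilon>) * (fst (p k))\<^sup>2"
    for \<epsilon> :: real and m and p :: "nat \<Rightarrow> real \<times> real"
  proof (cases "\<epsilon> \<ge> 1/2")
    case True
    have "norm ((f ^^ k) 0 - p k) \<le> \<epsilon>" if "k \<le> m" for k
      using pK that True by (auto simp: funpow_f_zero intro: less_imp_le less_le_trans)
    then show ?thesis by blast
  next
    case False
    define d where "d = \<epsilon> / 16"
    have d: "0 \<le> d" "d \<le> 1/32" using \<epsilon> False by (auto simp: d_def)
    define u v where "u k = fst (p k)" and "v k = snd (p k)" for k
    define X Y where "X k = fst ((f ^^ k) (p 0))" and "Y k = snd ((f ^^ k) (p 0))" for k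
    have X: "X (Suc k) = X k / 2" and Y: "Y (Suc k) = Y k * (1 + (X k)\<^sup>2)" for k
      by (simp_all only: X_def Y_def funpow_f_Suc)
    have XY0: "X 0 = u 0" "Y 0 = v 0" by (simp_all add: X_def Y_def u_def v_def)
    have bounds: "\<bar>u k\<bar> \<le> 1/2" "\<bar>v k\<bar> \<le> 1/2" if "k \<le> m" for k
    proof -
      have "norm (p k) < 1/2" using pK that by simp
      then show "\<bar>u k\<bar> \<le> 1/2" "\<bar>v k\<bar> \<le> 1/2"
        using norm_fst_le[of "fst (p k)" "snd (p k)"] norm_snd_le[of "snd (p k)" "fst (p k)"]
        by (simp_all add: u_def v_def)
    qed
    have step: "\<bar>u k / 2 - u (Suc k)\<bar> \<le> d * (u k)\<^sup>2"
        "\<bar>v k * (1 + (u k)\<^sup>2) - v (Suc k)\<bar> \<le> d * (u k)\<^sup>2" if "k < m" for k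
    proof -
      let ?z = "f (p k) - p (Suc k)"
      have z: "?z = (u k / 2 - u (Suc k), v k * (1 + (u k)\<^sup>2) - v (Suc k))"
        by (simp add: f_def u_def v_def prod_eq_iff split: prod.split)
      have "norm ?z \<le> d * (u k)\<^sup>2" using ps that by (simp add: d_def u_def)
      then show "\<bar>u k / 2 - u (Suc k)\<bar> \<le> d * (u k)\<^sup>2"
        "\<bar>v k * (1 + (u k)\<^sup>2) - v (Suc k)\<bar> \<le> d * (u k)\<^sup>2"
        using norm_fst_le[of "fst ?z" "snd ?z"] norm_snd_le[of "snd ?z" "fst ?z"]
        by (auto simp: z)
    qed
    note first = shadowing_first[where X = X and m = m, OF d bounds(1)[of 0] XY0(1) X step(1)]
    have "norm ((f ^^ k) (p 0) - p k) \<le> \<epsilon>" if "k \<le> m" for k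
    proof -
      have q: "0 < (9/16 :: real)^k" "(9/16 :: real)^k \<le> 1" by (simp_all add: power_le_one)
      have "\<bar>u k - X k\<bar> \<le> 4 * d * (9/16)^k" using first(3) that by simp
      also have "\<dots> \<le> 4 * d" using d q by (simp add: mult_left_le)
      finally have x: "\<bar>u k - X k\<bar> \<le> 4 * d" .
      have "\<bar>v k - Y k\<bar> \<le> 12 * d * (1 - (9/16)^k)"
        by (rule shadowing_second[where u = u and X = X and m = m])
          (use d XY0 Y step bounds first that in auto)
      also have "\<dots> \<le> 12 * d" using d q by (simp add: mult_left_le)
      finally have y: "\<bar>v k - Y k\<bar> \<le> 12 * d" .
      have "(f ^^ k) (p 0) - p k = (X k - u k, Y k - v k)"
        by (simp add: X_def Y_def u_def v_def prod_eq_iff)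
      then have "norm ((f ^^ k) (p 0) - p k) \<le> \<bar>X k - u k\<bar> + \<bar>Y k - v k\<bar>"
        using norm_Pair_le[of "X k - u k" "Y k - v k"] by simp
      \<comment> \<open>The choice c = 1/16 comes from here: 4 d + 12 d = 16 d =
        \<open>\<epsilon>\<close>.\<close>
      also have "\<dots> \<le> \<epsilon>" using x y unfolding d_def by linarith
      finally show ?thesis .
    qed
    then show ?thesis by blast
  qed
  then show ?thesis
    by (intro exI[of _ ?K] exI[of _ "1/16"]) (simp add: interior_open)
qed

end
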